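(* Let $H=(a_1,a_2)\subset\mathbb{R}$ be a bounded open interval, $\mathcal{B}$ a finite index set, and $m\ge 1$ an integer. Assume (H5.1): for each $b\in\mathcal{B}$, $g_b\in C^m(\bar H)$, $\theta_b\in C^m(\bar H)$, $g_b(x)>0$ for all $x\in\bar H$, $\theta_b(H)\subset H$; and there exist an integer $\mu\ge1$ and a real $\kappa<1$ such that $|\theta_\omega(x)-\theta_\omega(y)|\le\kappa|x-y|$ for all $\omega\in\mathcal{B}_\mu$ and all $x,y\in\bar H$. Let $$C_1=\sup\Big\{\frac{|g_\omega'(x)|}{g_\omega(x)}:\omega\in\mathcal{B}_\mu,\ x\in\bar H\Big\}.$$ For $s>0$ let $v_s\in C^m(\bar H)$ be the (unique up to positive scalar multiples) strictly positive eigenfunction of $\Lambda_s$ (its eigenvalue being $r(\Lambda_s)$). Then $$\sup\Big\{\frac{|v_s'(x)|}{v_s(x)}:x\in\bar H\Big\}\le\frac{C_1 s}{1-\kappa}.$$ Moreover, if $\delta\in\{0,1\}$ and $(-1)^\delta g_\omega'(x)/g_\omega(x)\le 0$ for all $\omega\in\mathcal{B}_\nu$, all $\nu\ge1$ and all $x\in\bar H$, then $(-1)^\delta v_s'(x)\le 0$ for all $x\in\bar H$ and all $s>0$.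
   Context: For $\nu\ge1$, $\mathcal{B}_\nu=\{\omega=(b_1,\dots,b_\nu): b_j\in\mathcal{B}\}$. For $\omega=(b_1,\dots,b_\nu)$, $\theta_\omega=\theta_{b_\nu}\circ\theta_{b_{\nu-1}}\circ\cdots\circ\theta_{b_1}$ and $g_\omega(x)=g_{b_\nu}(\theta_{b_{\nu-1}}\circ\cdots\circ\theta_{b_1}(x))\cdots g_{b_3}(\theta_{b_2}\circ\theta_{b_1}(x))\,g_{b_2}(\theta_{b_1}(x))\,g_{b_1}(x)$. For $s\ge0$, $L_s:C(\bar H)\to C(\bar H)$ is $(L_sw)(x)=\sum_{b\in\mathcal{B}}[g_b(x)]^s w(\theta_b(x))$, and $\Lambda_s$ is the restriction of $L_s$ to $C^m(\bar H)$ (the Banach space of real $C^m$ functions on $H$ whose derivatives of order $\le m$ extend continuously to $\bar H$), viewed as a bounded operator on $C^m(\bar H)$; $r(\Lambda_s)$ is its spectral radius. Strictly positive means $>0$ at every point of $\bar H$. *)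

theory Defs
  imports "HOL-Analysis.Analysis"
begin

text \<open>
  Throughout, \<open>H\<close> is the open interval \<open>{a<..<b}\<close> and its closure is \<open>{a..b}\<close>. Functions on the
  closure are total functions on the reals; values outside \<open>{a..b}\<close> are irrelevant.
\<close>

text \<open>
  The continuous extension to \<open>{a..b}\<close> of the \<open>k\<close>-th derivative of \<open>f\<close> on \<open>{a<..<b}\<close>. For members of
  \<open>Cm_space\<close> below the limit exists, and it is the derivative itself at interior points.
\<close>

definition ext_deriv :: "real \<Rightarrow> real \<Rightarrow> nat \<Rightarrow> (real \<Rightarrow> real) \<Rightarrow> real \<Rightarrow> real" where
  "ext_deriv a b k f x = Lim (at x within {a<..<b}) ((deriv ^^ k) f)"

text \<open>
  Continuity of \<open>f\<close> on \<open>{a..b}\<close> says that the values of \<open>f\<close> at the endpoints are those of its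
  continuous extension.
\<close>

definition Cm_space :: "real \<Rightarrow> real \<Rightarrow> nat \<Rightarrow> (real \<Rightarrow> real) set" where
  "Cm_space a b m = {f.
     continuous_on {a..b} f \<and>
     (\<forall>k<m. \<forall>x\<in>{a<..<b}. ((deriv ^^ k) f) differentiable (at x)) \<and>
     (\<forall>k\<le>m. \<exists>F. continuous_on {a..b} F \<and> (\<forall>x\<in>{a<..<b}. F x = (deriv ^^ k) f x))}"

definition Cm_norm :: "real \<Rightarrow> real \<Rightarrow> nat \<Rightarrow> (real \<Rightarrow> real) \<Rightarrow> real" where
  "Cm_norm a b m f = (MAX k\<in>{..m}. SUP x\<in>{a..b}. \<bar>ext_deriv a b k f x\<bar>)"

text \<open>
  The spectrum of an operator on a real Banach space is that of its complexification; the
  complexification of the space of real \<open>C\<^sup>m\<close> functions consists of complex-valued functions.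
\<close>

definition Cm_space_complex :: "real \<Rightarrow> real \<Rightarrow> nat \<Rightarrow> (real \<Rightarrow> complex) set" where
  "Cm_space_complex a b m =
     {u. (\<lambda>x. Re (u x)) \<in> Cm_space a b m \<and> (\<lambda>x. Im (u x)) \<in> Cm_space a b m}"

definition Cm_norm_complex :: "real \<Rightarrow> real \<Rightarrow> nat \<Rightarrow> (real \<Rightarrow> complex) \<Rightarrow> real" where
  "Cm_norm_complex a b m u = Cm_norm a b m (\<lambda>x. Re (u x)) + Cm_norm a b m (\<lambda>x. Im (u x))"

definition complexify ::
  "((real \<Rightarrow> real) \<Rightarrow> real \<Rightarrow> real) \<Rightarrow> (real \<Rightarrow> complex) \<Rightarrow> real \<Rightarrow> complex" where
  "complexify T u x = Complex (T (\<lambda>y. Re (u y)) x) (T (\<lambda>y. Im (u y)) x)"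

text \<open>
  \<open>z\<close> is in the resolvent set iff \<open>z I - T\<close> maps the complexified space bijectively onto itself with
  bounded inverse. Equality of functions means equality on \<open>{a..b}\<close>; the lower bound in the second
  conjunct expresses injectivity together with boundedness of the inverse.
\<close>

definition Cm_resolvent_set ::
  "real \<Rightarrow> real \<Rightarrow> nat \<Rightarrow> ((real \<Rightarrow> real) \<Rightarrow> real \<Rightarrow> real) \<Rightarrow> complex set" where
  "Cm_resolvent_set a b m T = {z.
     (\<forall>f\<in>Cm_space_complex a b m. \<exists>u\<in>Cm_space_complex a b m.
        \<forall>x\<in>{a..b}. z * u x - complexify T u x = f x) \<and>
     (\<exists>K. \<forall>u\<in>Cm_space_complex a b m.
        Cm_norm_complex a b m u \<le> K * Cm_norm_complex a b m (\<lambda>x. z * u x - complexify T u x))}"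

definition Cm_spectral_radius ::
  "real \<Rightarrow> real \<Rightarrow> nat \<Rightarrow> ((real \<Rightarrow> real) \<Rightarrow> real \<Rightarrow> real) \<Rightarrow> real" where
  "Cm_spectral_radius a b m T = (SUP z\<in>- Cm_resolvent_set a b m T. cmod z)"

definition transfer_op ::
  "'i set \<Rightarrow> ('i \<Rightarrow> real \<Rightarrow> real) \<Rightarrow> ('i \<Rightarrow> real \<Rightarrow> real) \<Rightarrow> real \<Rightarrow> (real \<Rightarrow> real) \<Rightarrow> real \<Rightarrow> real" where
  "transfer_op B g \<theta> s w x = (\<Sum>i\<in>B. (g i x) powr s * w (\<theta> i x))"

text \<open>A word \<open>(b\<^sub>1, \<dots>, b\<^sub>\<nu>)\<close> is the list of its letters, so the list index is shifted by one.\<close>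

definition words :: "'i set \<Rightarrow> nat \<Rightarrow> 'i list set" where
  "words B \<nu> = {\<omega>. length \<omega> = \<nu> \<and> set \<omega> \<subseteq> B}"

text \<open>\<open>fold\<close> applies the map of the first letter first.\<close>

definition theta_word :: "('i \<Rightarrow> real \<Rightarrow> real) \<Rightarrow> 'i list \<Rightarrow> real \<Rightarrow> real" where
  "theta_word \<theta> \<omega> = fold \<theta> \<omega>"

definition g_word ::
  "('i \<Rightarrow> real \<Rightarrow> real) \<Rightarrow> ('i \<Rightarrow> real \<Rightarrow> real) \<Rightarrow> 'i list \<Rightarrow> real \<Rightarrow> real" where
  "g_word g \<theta> \<omega> x = (\<Prod>j<length \<omega>. g (\<omega> ! j) (theta_word \<theta> (take j \<omega>) x))"

definition positive_eigenfunction ::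
  "real \<Rightarrow> real \<Rightarrow> nat \<Rightarrow> 'i set \<Rightarrow> ('i \<Rightarrow> real \<Rightarrow> real) \<Rightarrow> ('i \<Rightarrow> real \<Rightarrow> real) \<Rightarrow> real \<Rightarrow>
     (real \<Rightarrow> real) \<Rightarrow> bool" where
  "positive_eigenfunction a b m B g \<theta> s v \<longleftrightarrow>
     v \<in> Cm_space a b m \<and> (\<forall>x\<in>{a..b}. v x > 0) \<and>
     (\<forall>x\<in>{a..b}. transfer_op B g \<theta> s v x = Cm_spectral_radius a b m (transfer_op B g \<theta> s) * v x)"

end

theory Submission
  imports Defs
begin

text \<open>
  Iterating the eigenvalue equation gives \<open>\<lambda>\<^sup>\<nu> v = (\<Sum>\<omega>. g\<^sub>\<omega>\<^sup>s (v \<circ> \<theta>\<^sub>\<omega>))\<close>, the sum over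
  words of length \<open>\<nu>\<close>. In the derivative of the right-hand side a factor \<open>g\<^sub>\<omega>'\<close> costs at most
  \<open>C\<^sub>1 g\<^sub>\<omega>\<close> and a factor \<open>\<theta>\<^sub>\<omega>'\<close> at most \<open>\<kappa>\<close>, so for \<open>\<nu> = \<mu>\<close> the finite number
  \<open>M = sup \<bar>v'\<bar> / v\<close> satisfies \<open>M \<le> s C\<^sub>1 + \<kappa> M\<close>. For the sign of \<open>v'\<close>, take \<open>\<nu> = n \<mu>\<close>: the
  terms with \<open>g\<^sub>\<omega>'\<close> have the required sign, the others are at most \<open>M \<kappa>\<^sup>n v\<close> in total, and
  \<open>n \<rightarrow> \<infinity>\<close>.
\<close>

text \<open>At order 1, differentiability and the extension of \<open>deriv f\<close> merge into a
  single witness \<open>F\<close>. This is the form in which products and composites can be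
  checked.\<close>

lemma Cm_space_1_iff:
  "f \<in> Cm_space a b 1 \<longleftrightarrow> continuous_on {a..b} f \<and>
     (\<exists>F. continuous_on {a..b} F \<and> (\<forall>x\<in>{a<..<b}. (f has_real_derivative F x) (at x)))"
  (is "_ \<longleftrightarrow> ?R")
proof
  assume f: "f \<in> Cm_space a b 1"
  then have "\<exists>F. continuous_on {a..b} F \<and> (\<forall>x\<in>{a<..<b}. F x = (deriv ^^ 1) f x)"
    unfolding Cm_space_def by blast
  then obtain F where F: "continuous_on {a..b} F" "\<And>x. x \<in> {a<..<b} \<Longrightarrow> F x = deriv f x"
    by auto
  have "(f has_real_derivative F x) (at x)" if "x \<in> {a<..<b}" for x
  proof -
    have "f differentiable (at x)"
      using f that unfolding Cm_space_def by auto
    then show ?thesis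
      using F(2)[OF that] DERIV_deriv_iff_real_differentiable by metis
  qed
  then show ?R
    using f F unfolding Cm_space_def by blast
next
  assume ?R
  then obtain F where c: "continuous_on {a..b} f" and F: "continuous_on {a..b} F"
    and D: "\<And>x. x \<in> {a<..<b} \<Longrightarrow> (f has_real_derivative F x) (at x)"
    by blast
  have "\<exists>F. continuous_on {a..b} F \<and> (\<forall>x\<in>{a<..<b}. F x = (deriv ^^ k) f x)" if "k \<le> 1" for k
  proof (cases k)
    case 0
    then show ?thesis using c by auto
  next
    case (Suc n)
    then have "k = 1" using that by simp
    then show ?thesis using F D DERIV_imp_deriv[OF D] by (intro exI[of _ F]) simp
  qed
  moreover have "f differentiable (at x)" if "x \<in> {a<..<b}" for x
    using D[OF that] real_differentiable_def by blast
  ultimately show "f \<in> Cm_space a b 1"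
    using c unfolding Cm_space_def by auto
qed

lemma Cm_space_1I:
  assumes "continuous_on {a..b} f" "continuous_on {a..b} F"
    and "\<And>x. x \<in> {a<..<b} \<Longrightarrow> (f has_real_derivative F x) (at x)"
  shows "f \<in> Cm_space a b 1"
  using assms unfolding Cm_space_1_iff by blast

lemma Cm_space_antimono: "k \<le> m \<Longrightarrow> Cm_space a b m \<subseteq> Cm_space a b k"
  unfolding Cm_space_def by auto

lemma Cm_space_continuous: "f \<in> Cm_space a b m \<Longrightarrow> continuous_on {a..b} f"
  unfolding Cm_space_def by simp

text \<open>A continuous \<open>F\<close> that equals the derivative inside is its own limit at
  every point of \<open>{a..b}\<close>. Each such point, endpoints included, is a limit point of the
  open interval, so the limit defining \<open>ext_deriv\<close> is unique and equals
  \<open>F\<close>.\<close>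

lemma
  assumes "a < b" "f \<in> Cm_space a b 1"
  shows ext_deriv_1_continuous: "continuous_on {a..b} (ext_deriv a b 1 f)"
    and ext_deriv_1_DERIV:
      "x \<in> {a<..<b} \<Longrightarrow> (f has_real_derivative ext_deriv a b 1 f x) (at x)"
proof -
  obtain F where F: "continuous_on {a..b} F"
    and D: "\<And>x. x \<in> {a<..<b} \<Longrightarrow> (f has_real_derivative F x) (at x)"
    using assms(2) unfolding Cm_space_1_iff by blast
  have eq: "ext_deriv a b 1 f x = F x" if x: "x \<in> {a..b}" for x
  proof -
    have "(F \<longlongrightarrow> F x) (at x within {a<..<b})"
      by (rule tendsto_within_subset[of _ _ _ "{a..b}"]) (use F x in \<open>auto simp: continuous_on_def\<close>)
    moreover have "eventually (\<lambda>y. F y = (deriv ^^ 1) f y) (at x within {a<..<b})"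
      unfolding eventually_at_filter by (rule always_eventually) (simp add: D[THEN DERIV_imp_deriv])
    ultimately have "((deriv ^^ 1) f \<longlongrightarrow> F x) (at x within {a<..<b})"
      by (simp add: tendsto_cong)
    moreover have "at x within {a<..<b} \<noteq> bot"
      using x assms(1) islimpt_closure_open[of "{a<..<b}" _ x]
      by (simp add: trivial_limit_within flip: limpt_of_closure[of x "{a<..<b}"])
    ultimately show ?thesis
      unfolding ext_deriv_def by (rule tendsto_Lim[rotated])
  qed
  show "continuous_on {a..b} (ext_deriv a b 1 f)"
    using F by (rule continuous_on_eq) (rule eq[symmetric])
  show "(f has_real_derivative ext_deriv a b 1 f x) (at x)" if "x \<in> {a<..<b}"
    using D[OF that] eq[of x] that by simp
qed

lemma Cm_space_1_mult:
  assumes "a < b" "f \<in> Cm_space a b 1" "h \<in> Cm_space a b 1"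
  shows "(\<lambda>x. f x * h x) \<in> Cm_space a b 1"
proof (rule Cm_space_1I)
  let ?F = "\<lambda>x. ext_deriv a b 1 f x * h x + ext_deriv a b 1 h x * f x"
  note [continuous_intros] = assms(2,3)[THEN Cm_space_continuous]
    assms(2,3)[THEN ext_deriv_1_continuous[OF assms(1)]]
  show "continuous_on {a..b} (\<lambda>x. f x * h x)" "continuous_on {a..b} ?F"
    by (intro continuous_intros)+
  show "((\<lambda>x. f x * h x) has_real_derivative ?F x) (at x)" if "x \<in> {a<..<b}" for x
    using assms that by (intro DERIV_mult ext_deriv_1_DERIV)
qed

text \<open>The two range conditions serve different ends: the open one lets the chain rule apply at
  interior points, the closed one makes the candidate derivative continuous up to the
  endpoints.\<close>

lemma Cm_space_1_compose:
  assumes "a < b" "f \<in> Cm_space a b 1" "h \<in> Cm_space a b 1"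
    and "h ` {a<..<b} \<subseteq> {a<..<b}" "h ` {a..b} \<subseteq> {a..b}"
  shows "(\<lambda>x. f (h x)) \<in> Cm_space a b 1"
proof (rule Cm_space_1I)
  let ?F = "\<lambda>x. ext_deriv a b 1 f (h x) * ext_deriv a b 1 h x"
  note c = assms(2,3)[THEN Cm_space_continuous]
    assms(2,3)[THEN ext_deriv_1_continuous[OF assms(1)]]
  show "continuous_on {a..b} (\<lambda>x. f (h x))"
    using continuous_on_compose2[OF c(1,2) assms(5)] .
  show "continuous_on {a..b} ?F"
    using continuous_on_compose2[OF c(3,2) assms(5)] c(4) by (rule continuous_on_mult)
  show "((\<lambda>x. f (h x)) has_real_derivative ?F x) (at x)" if "x \<in> {a<..<b}" for x
    using assms that by (intro DERIV_chain2[of f] ext_deriv_1_DERIV) (simp_all add: image_subset_iff)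
qed

section \<open>Inequalities and bounds for real functions on an interval\<close>

text \<open>Density of the interior. Derivative formulas hold only at interior points; this carries
  the resulting estimates to the endpoints.\<close>

lemma continuous_le_on_closed_interval:
  fixes f h :: "real \<Rightarrow> real"
  assumes "a < b" "continuous_on {a..b} f" "continuous_on {a..b} h"
    and "\<And>x. x \<in> {a<..<b} \<Longrightarrow> f x \<le> h x" and x: "x \<in> {a..b}"
  shows "f x \<le> h x"
proof -
  have cl: "closure {a<..<b} = {a..b}" using assms(1) by simp
  have "continuous_on (closure {a<..<b}) (\<lambda>x. f x - h x)"
    unfolding cl using assms(2,3) by (rule continuous_on_diff)
  then have "f x - h x \<le> 0"
    by (rule continuous_le_on_closure) (use assms(4) x cl in auto)
  then show ?thesis by simp
qed

text \<open>All difference quotients near \<open>x\<close> are bounded by \<open>K\<close>, hence so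
  is their limit. It turns the contraction hypothesis into a bound on the derivative of
  \<open>theta_word\<close>.\<close>

lemma DERIV_abs_le_Lipschitz:
  fixes f :: "real \<Rightarrow> real"
  assumes D: "(f has_real_derivative D) (at x)" and "open S" "x \<in> S"
    and "\<And>y. y \<in> S \<Longrightarrow> \<bar>f y - f x\<bar> \<le> K * \<bar>y - x\<bar>"
  shows "\<bar>D\<bar> \<le> K"
proof -
  have lim: "((\<lambda>y. \<bar>(f y - f x) / (y - x)\<bar>) \<longlongrightarrow> \<bar>D\<bar>) (at x)"
    using D unfolding has_field_derivative_iff by (rule tendsto_rabs)
  have "eventually (\<lambda>y. y \<in> S - {x}) (at x)"
    using assms(2,3) by (rule eventually_at_in_open)
  then have "eventually (\<lambda>y. \<bar>(f y - f x) / (y - x)\<bar> \<le> K) (at x)"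
    by eventually_elim (use assms(4) in \<open>auto simp: abs_divide pos_divide_le_eq\<close>)
  with lim show ?thesis by (rule tendsto_upperbound) simp
qed

text \<open>Compactness. Boundedness has to be secured before a real \<open>Sup\<close> can serve as
  an upper bound.\<close>

lemma bdd_above_abs_ratio:
  fixes u v :: "real \<Rightarrow> real"
  assumes "continuous_on {a..b} u" "continuous_on {a..b} v" "\<And>x. x \<in> {a..b} \<Longrightarrow> v x > 0"
  shows "bdd_above ((\<lambda>x. \<bar>u x\<bar> / v x) ` {a..b})"
proof -
  have "v x \<noteq> 0" if "x \<in> {a..b}" for x using assms(3)[OF that] by simp
  then have "continuous_on {a..b} (\<lambda>x. \<bar>u x\<bar> / v x)"
    using assms by (intro continuous_intros) auto
  then show ?thesis
    by (intro bounded_imp_bdd_above compact_imp_bounded compact_continuous_image) simp_all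
qed

section \<open>Words and their recursion on the first letter\<close>

lemma theta_word_Nil [simp]: "theta_word \<theta> [] x = x"
  and theta_word_Cons [simp]: "theta_word \<theta> (i # \<omega>) x = theta_word \<theta> \<omega> (\<theta> i x)"
  and theta_word_append: "theta_word \<theta> (\<omega> @ \<omega>') x = theta_word \<theta> \<omega>' (theta_word \<theta> \<omega> x)"
  by (simp_all add: theta_word_def)

lemma g_word_Nil [simp]: "g_word g \<theta> [] x = 1"
  by (simp add: g_word_def)

text \<open>The factor \<open>j = 0\<close> has an empty prefix and gives \<open>g i x\<close>;
  every later prefix begins with \<open>i\<close>, so the remaining factors form the weight of the
  tail at \<open>\<theta> i x\<close>.\<close>

lemma g_word_Cons [simp]: "g_word g \<theta> (i # \<omega>) x = g i x * g_word g \<theta> \<omega> (\<theta> i x)"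
  by (simp add: g_word_def prod.lessThan_Suc_shift del: prod.lessThan_Suc)

lemma finite_words: "finite B \<Longrightarrow> finite (words B n)"
  by (rule rev_finite_subset[OF finite_lists_length_eq[of B n]]) (auto simp: words_def)

lemma words_nonempty: "B \<noteq> {} \<Longrightarrow> words B n \<noteq> {}"
proof -
  assume "B \<noteq> {}"
  then obtain i where "i \<in> B" by blast
  then have "replicate n i \<in> words B n" by (auto simp: words_def)
  then show ?thesis by blast
qed

lemma words_0 [simp]: "words B 0 = {[]}"
  by (auto simp: words_def)

lemma sum_words_Suc:
  "(\<Sum>\<omega>\<in>words B (Suc n). F \<omega>) = (\<Sum>i\<in>B. \<Sum>\<omega>\<in>words B n. F (i # \<omega>))"
proof -
  have "(\<Sum>\<omega>\<in>words B (Suc n). F \<omega>) = (\<Sum>(i, \<omega>)\<in>B \<times> words B n. F (i # \<omega>))"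
    by (rule sum.reindex_bij_witness[of _ "\<lambda>(i, \<omega>). i # \<omega>" "\<lambda>\<omega>. (hd \<omega>, tl \<omega>)"])
       (auto simp: words_def length_Suc_conv)
  then show ?thesis by (simp add: sum.cartesian_product)
qed

section \<open>Regularity, positivity and contraction of the word maps and weights\<close>

locale C1_system =
  fixes a b :: real and B :: "'i set" and g \<theta> :: "'i \<Rightarrow> real \<Rightarrow> real"
  assumes ab: "a < b" and fin: "finite B" and nonempty: "B \<noteq> {}"
    and g_C1: "i \<in> B \<Longrightarrow> g i \<in> Cm_space a b 1"
    and \<theta>_C1: "i \<in> B \<Longrightarrow> \<theta> i \<in> Cm_space a b 1"
    and g_pos: "i \<in> B \<Longrightarrow> x \<in> {a..b} \<Longrightarrow> g i x > 0"
    and \<theta>_maps: "i \<in> B \<Longrightarrow> \<theta> i ` {a<..<b} \<subseteq> {a<..<b}"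
begin

text \<open>A continuous map sends the closure of the open interval into any closed set that
  contains the image of the open interval.\<close>

lemma \<theta>_maps_closed:
  assumes "i \<in> B" shows "\<theta> i ` {a..b} \<subseteq> {a..b}"
proof -
  have "continuous_on (closure {a<..<b}) (\<theta> i)"
    using Cm_space_continuous[OF \<theta>_C1[OF assms]] ab by simp
  then have "\<theta> i ` closure {a<..<b} \<subseteq> {a..b}"
    by (rule image_closure_subset) (use \<theta>_maps[OF assms] in fastforce)+
  then show ?thesis using ab by simp
qed

lemma theta_word_maps:
  assumes "\<omega> \<in> words B n"
  shows "theta_word \<theta> \<omega> ` {a<..<b} \<subseteq> {a<..<b}" "theta_word \<theta> \<omega> ` {a..b} \<subseteq> {a..b}"
proof -
  have "set \<omega> \<subseteq> B" using assms by (simp add: words_def)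
  then have "theta_word \<theta> \<omega> ` {a<..<b} \<subseteq> {a<..<b} \<and> theta_word \<theta> \<omega> ` {a..b} \<subseteq> {a..b}"
  proof (induction \<omega>)
    case (Cons i \<omega>)
    then have "i \<in> B" by simp
    from Cons \<theta>_maps[OF this] \<theta>_maps_closed[OF this] show ?case
      by (auto simp: image_subset_iff)
  qed simp
  then show "theta_word \<theta> \<omega> ` {a<..<b} \<subseteq> {a<..<b}" "theta_word \<theta> \<omega> ` {a..b} \<subseteq> {a..b}"
    by auto
qed

lemma theta_word_C1:
  assumes "\<omega> \<in> words B n"
  shows "theta_word \<theta> \<omega> \<in> Cm_space a b 1"
proof -
  have "set \<omega> \<subseteq> B" using assms by (simp add: words_def)
  then show ?thesis
  proof (induction \<omega>)
    case Nil
    show ?case by (rule Cm_space_1I[where F = "\<lambda>_. 1"]) auto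
  next
    case (Cons i \<omega>)
    then have i: "i \<in> B" and IH: "theta_word \<theta> \<omega> \<in> Cm_space a b 1" by auto
    have "(\<lambda>x. theta_word \<theta> \<omega> (\<theta> i x)) \<in> Cm_space a b 1"
      by (rule Cm_space_1_compose[OF ab IH \<theta>_C1[OF i] \<theta>_maps[OF i] \<theta>_maps_closed[OF i]])
    also have "(\<lambda>x. theta_word \<theta> \<omega> (\<theta> i x)) = theta_word \<theta> (i # \<omega>)"
      by (simp add: fun_eq_iff)
    finally show ?case .
  qed
qed

lemma g_word_C1:
  assumes "\<omega> \<in> words B n"
  shows "g_word g \<theta> \<omega> \<in> Cm_space a b 1"
proof -
  have "set \<omega> \<subseteq> B" using assms by (simp add: words_def)
  then show ?thesis
  proof (induction \<omega>)
    case Nil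
    show ?case by (rule Cm_space_1I[where F = "\<lambda>_. 0"]) auto
  next
    case (Cons i \<omega>)
    then have i: "i \<in> B" and IH: "g_word g \<theta> \<omega> \<in> Cm_space a b 1" by auto
    have "(\<lambda>x. g_word g \<theta> \<omega> (\<theta> i x)) \<in> Cm_space a b 1"
      by (rule Cm_space_1_compose[OF ab IH \<theta>_C1[OF i] \<theta>_maps[OF i] \<theta>_maps_closed[OF i]])
    then have "(\<lambda>x. g i x * g_word g \<theta> \<omega> (\<theta> i x)) \<in> Cm_space a b 1"
      by (rule Cm_space_1_mult[OF ab g_C1[OF i]])
    also have "(\<lambda>x. g i x * g_word g \<theta> \<omega> (\<theta> i x)) = g_word g \<theta> (i # \<omega>)"
      by (simp add: fun_eq_iff)
    finally show ?case .
  qed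
qed

lemma g_word_pos:
  assumes "\<omega> \<in> words B n" "x \<in> {a..b}"
  shows "g_word g \<theta> \<omega> x > 0"
proof -
  have "set \<omega> \<subseteq> B" using assms(1) by (simp add: words_def)
  then show ?thesis
    using assms(2)
  proof (induction \<omega> arbitrary: x)
    case (Cons i \<omega>)
    then have "\<theta> i x \<in> {a..b}" using \<theta>_maps_closed[of i] by (simp add: image_subset_iff)
    with Cons g_pos[of i x] show ?case by auto
  qed simp
qed

text \<open>Cut the word after its first \<open>\<mu>\<close> letters. This prefix acts first and
  contributes one factor \<open>K\<close>; the rest contributes \<open>K ^ n\<close> by induction,
  applied at the images of \<open>x\<close> and \<open>y\<close>.\<close>

lemma Lipschitz_theta_word_iterate:
  assumes "K \<ge> 0"
    and K: "\<And>\<omega> x y. \<omega> \<in> words B \<mu> \<Longrightarrow> x \<in> {a..b} \<Longrightarrow> y \<in> {a..b} \<Longrightarrow>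
           \<bar>theta_word \<theta> \<omega> x - theta_word \<theta> \<omega> y\<bar> \<le> K * \<bar>x - y\<bar>"
    and "\<omega> \<in> words B (n * \<mu>)" "x \<in> {a..b}" "y \<in> {a..b}"
  shows "\<bar>theta_word \<theta> \<omega> x - theta_word \<theta> \<omega> y\<bar> \<le> K ^ n * \<bar>x - y\<bar>"
  using assms(3-5)
proof (induction n arbitrary: \<omega> x y)
  case 0
  then show ?case by simp
next
  case (Suc n)
  define u w where "u = take \<mu> \<omega>" and "w = drop \<mu> \<omega>"
  have u: "u \<in> words B \<mu>" and w: "w \<in> words B (n * \<mu>)" and \<omega>: "\<omega> = u @ w"
    using Suc.prems(1) set_take_subset[of \<mu> \<omega>] set_drop_subset[of \<mu> \<omega>]
    by (auto simp: words_def u_def w_def)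
  have "theta_word \<theta> u x \<in> {a..b}" "theta_word \<theta> u y \<in> {a..b}"
    using theta_word_maps(2)[OF u] Suc.prems by (simp_all add: image_subset_iff)
  with w have "\<bar>theta_word \<theta> \<omega> x - theta_word \<theta> \<omega> y\<bar>
      \<le> K ^ n * \<bar>theta_word \<theta> u x - theta_word \<theta> u y\<bar>"
    unfolding \<omega> theta_word_append by (rule Suc.IH)
  also have "\<dots> \<le> K ^ n * (K * \<bar>x - y\<bar>)"
    using K[OF u Suc.prems(2,3)] assms(1) by (intro mult_left_mono) auto
  finally show ?case by (simp add: mult_ac)
qed

end

section \<open>The iterated eigenvalue equation and its derivative\<close>

locale positive_eigenvector = C1_system +
  fixes s ev :: real and v :: "real \<Rightarrow> real"
  assumes v_C1: "v \<in> Cm_space a b 1" and v_pos: "x \<in> {a..b} \<Longrightarrow> v x > 0"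
    and eigen: "x \<in> {a..b} \<Longrightarrow> transfer_op B g \<theta> s v x = ev * v x"
begin

text \<open>At the point \<open>a\<close> the operator yields a nonempty sum of positive terms, and
  \<open>v a\<close> is positive. Positivity later allows \<open>ev ^ n\<close> to be cancelled from
  inequalities.\<close>

lemma ev_pos: "ev > 0"
proof -
  have a: "a \<in> {a..b}" using ab by simp
  have "\<theta> i a \<in> {a..b}" if "i \<in> B" for i
    using \<theta>_maps_closed[OF that] a by blast
  then have "transfer_op B g \<theta> s v a > 0"
    unfolding transfer_op_def
    using fin nonempty g_pos[OF _ a] v_pos
    by (intro sum_pos mult_pos_pos) (simp_all add: less_imp_neq[symmetric])
  then show ?thesis
    using eigen[OF a] v_pos[OF a] by (simp add: zero_less_mult_iff)
qed

text \<open>Apply the equation once at \<open>x\<close>, then the induction hypothesis at each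
  \<open>\<theta> i x\<close>; the letter \<open>i\<close> becomes the head of the longer
  word.\<close>

lemma eigen_iterate:
  "x \<in> {a..b} \<Longrightarrow>
    ev ^ n * v x = (\<Sum>\<omega>\<in>words B n. g_word g \<theta> \<omega> x powr s * v (theta_word \<theta> \<omega> x))"
proof (induction n arbitrary: x)
  case 0
  then show ?case by simp
next
  case (Suc n)
  have \<theta>x: "\<theta> i x \<in> {a..b}" if "i \<in> B" for i
    using \<theta>_maps_closed[OF that] Suc.prems by blast
  have "ev ^ Suc n * v x = ev ^ n * transfer_op B g \<theta> s v x"
    using eigen[OF Suc.prems] by simp
  also have "\<dots> = (\<Sum>i\<in>B. g i x powr s * (ev ^ n * v (\<theta> i x)))"
    by (simp add: transfer_op_def sum_distrib_left mult_ac)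
  also have "\<dots> = (\<Sum>i\<in>B. g i x powr s *
      (\<Sum>\<omega>\<in>words B n. g_word g \<theta> \<omega> (\<theta> i x) powr s * v (theta_word \<theta> \<omega> (\<theta> i x))))"
    using Suc.IH[OF \<theta>x] by simp
  also have "\<dots> = (\<Sum>i\<in>B. \<Sum>\<omega>\<in>words B n.
      g_word g \<theta> (i # \<omega>) x powr s * v (theta_word \<theta> (i # \<omega>) x))"
    using g_pos[OF _ Suc.prems] g_word_pos[OF _ \<theta>x]
    by (intro sum.cong refl) (simp add: sum_distrib_left powr_mult less_imp_le mult.assoc)
  finally show ?case by (simp add: sum_words_Suc)
qed

abbreviation "v' \<equiv> ext_deriv a b 1 v"
abbreviation "g' \<omega> \<equiv> ext_deriv a b 1 (g_word g \<theta> \<omega>)"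
abbreviation "\<theta>' \<omega> \<equiv> ext_deriv a b 1 (theta_word \<theta> \<omega>)"

text \<open>Termwise product and chain rule. Writing the derivative of the power through
  \<open>g' \<omega> x / g_word g \<theta> \<omega> x\<close> keeps the positive factor
  \<open>g_word g \<theta> \<omega> x powr s\<close> common to both parts of each term.\<close>

lemma eigen_iterate_deriv:
  assumes x: "x \<in> {a<..<b}"
  shows "ev ^ n * v' x = (\<Sum>\<omega>\<in>words B n. g_word g \<theta> \<omega> x powr s *
    (s * (g' \<omega> x / g_word g \<theta> \<omega> x) * v (theta_word \<theta> \<omega> x)
      + v' (theta_word \<theta> \<omega> x) * \<theta>' \<omega> x))" (is "_ = ?S")
proof -
  have x': "x \<in> {a..b}" using x by simp
  have summand: "((\<lambda>x. g_word g \<theta> \<omega> x powr s * v (theta_word \<theta> \<omega> x)) has_real_derivative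
      g_word g \<theta> \<omega> x powr s * (s * (g' \<omega> x / g_word g \<theta> \<omega> x) * v (theta_word \<theta> \<omega> x)
        + v' (theta_word \<theta> \<omega> x) * \<theta>' \<omega> x)) (at x)" if \<omega>: "\<omega> \<in> words B n" for \<omega>
  proof -
    have \<theta>x: "theta_word \<theta> \<omega> x \<in> {a<..<b}"
      using theta_word_maps(1)[OF \<omega>] x by blast
    note pos = g_word_pos[OF \<omega> x']
    have "((\<lambda>x. g_word g \<theta> \<omega> x powr s) has_real_derivative
        s * g_word g \<theta> \<omega> x powr (s - of_nat 1) * g' \<omega> x) (at x)"
      using pos by (intro DERIV_fun_powr ext_deriv_1_DERIV ab g_word_C1[OF \<omega>] x)
    moreover have "((\<lambda>x. v (theta_word \<theta> \<omega> x)) has_real_derivative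
        v' (theta_word \<theta> \<omega> x) * \<theta>' \<omega> x) (at x)"
      by (intro DERIV_chain2[of v] ext_deriv_1_DERIV ab v_C1 theta_word_C1[OF \<omega>] x \<theta>x)
    ultimately show ?thesis
      by (rule DERIV_cong[OF DERIV_mult]) (use pos in \<open>simp add: powr_diff field_simps\<close>)
  qed
  have "((\<lambda>x. \<Sum>\<omega>\<in>words B n. g_word g \<theta> \<omega> x powr s * v (theta_word \<theta> \<omega> x))
      has_real_derivative ?S) (at x)"
    by (rule DERIV_sum) (rule summand)
  \<comment> \<open>The iterated equation is known only on \<open>{a..b}\<close>; agreement on an
    open neighbourhood of \<open>x\<close> suffices for the derivative at \<open>x\<close>.\<close>
  then have "((\<lambda>x. ev ^ n * v x) has_real_derivative ?S) (at x)"
    by (rule has_field_derivative_transform_within_open[of _ _ _ "{a<..<b}"])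
       (use x eigen_iterate in auto)
  moreover have "((\<lambda>x. ev ^ n * v x) has_real_derivative ev ^ n * v' x) (at x)"
    by (intro DERIV_cmult ext_deriv_1_DERIV ab v_C1 x)
  ultimately show ?thesis by (rule DERIV_unique[rotated])
qed

section \<open>Bounds on the logarithmic derivative of the eigenfunction\<close>

definition "M = (SUP x\<in>{a..b}. \<bar>v' x\<bar> / v x)"

lemma abs_deriv_le_M:
  assumes "x \<in> {a..b}" shows "\<bar>v' x\<bar> \<le> M * v x"
proof -
  have "\<bar>v' x\<bar> / v x \<le> M"
    unfolding M_def using assms ab v_pos
    by (intro cSUP_upper bdd_above_abs_ratio ext_deriv_1_continuous v_C1
      Cm_space_continuous[OF v_C1]) auto
  then show ?thesis using v_pos[OF assms] by (simp add: pos_divide_le_eq)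
qed

text \<open>Both claims are instances: \<open>t = \<plusminus>1\<close>, \<open>n = \<mu>\<close> and \<open>c = C\<^sub>1\<close> for the first one, \<open>t = (-1)\<^sup>\<delta>\<close>,
  \<open>n\<close> a large multiple of \<open>\<mu>\<close> and \<open>c = 0\<close> for the second one.\<close>

lemma deriv_le:
  assumes "s \<ge> 0" "\<bar>t\<bar> = 1" "K \<ge> 0"
    and K: "\<And>\<omega> x y. \<omega> \<in> words B n \<Longrightarrow> x \<in> {a..b} \<Longrightarrow> y \<in> {a..b} \<Longrightarrow>
           \<bar>theta_word \<theta> \<omega> x - theta_word \<theta> \<omega> y\<bar> \<le> K * \<bar>x - y\<bar>"
    and c: "\<And>\<omega> x. \<omega> \<in> words B n \<Longrightarrow> x \<in> {a..b} \<Longrightarrow> t * (g' \<omega> x / g_word g \<theta> \<omega> x) \<le> c"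
    and x: "x \<in> {a..b}"
  shows "t * v' x \<le> (s * c + K * M) * v x"
\<comment> \<open>The differentiated equation is available at interior points only, so the estimate
  is proved there and extended by continuity.\<close>
proof (rule continuous_le_on_closed_interval[OF ab _ _ _ x])
  show "continuous_on {a..b} (\<lambda>x. t * v' x)" "continuous_on {a..b} (\<lambda>x. (s * c + K * M) * v x)"
    by (intro continuous_intros ext_deriv_1_continuous ab v_C1 Cm_space_continuous[OF v_C1])+
  fix x assume x: "x \<in> {a<..<b}"
  then have x': "x \<in> {a..b}" by simp
  \<comment> \<open>Each term of the differentiated equation is compared with the same constant
    times the matching term of the undifferentiated one, so that the sum of the bounds is again a
    multiple of \<open>ev ^ n * v x\<close>.\<close>
  have summand: "t * (g_word g \<theta> \<omega> x powr s *
        (s * (g' \<omega> x / g_word g \<theta> \<omega> x) * v (theta_word \<theta> \<omega> x)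
          + v' (theta_word \<theta> \<omega> x) * \<theta>' \<omega> x))
      \<le> (s * c + K * M) * (g_word g \<theta> \<omega> x powr s * v (theta_word \<theta> \<omega> x))"
    if \<omega>: "\<omega> \<in> words B n" for \<omega>
  proof -
    define y where "y = theta_word \<theta> \<omega> x"
    have y: "y \<in> {a..b}" using theta_word_maps(2)[OF \<omega>] x' unfolding y_def by blast
    have "s * (t * (g' \<omega> x / g_word g \<theta> \<omega> x)) * v y \<le> s * c * v y"
      using c[OF \<omega> x'] v_pos[OF y] assms(1) by (intro mult_right_mono mult_left_mono) auto
    moreover have "t * (v' y * \<theta>' \<omega> x) \<le> K * M * v y"
    proof -
      have "\<bar>\<theta>' \<omega> x\<bar> \<le> K"
      proof (rule DERIV_abs_le_Lipschitz[OF ext_deriv_1_DERIV[OF ab theta_word_C1[OF \<omega>] x]])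
        show "open {a<..<b}" "x \<in> {a<..<b}" using x by auto
      qed (use K[OF \<omega> _ x'] in auto)
      then have "\<bar>v' y\<bar> * \<bar>\<theta>' \<omega> x\<bar> \<le> (M * v y) * K"
        using abs_deriv_le_M[OF y] by (intro mult_mono) auto
      moreover have "t * (v' y * \<theta>' \<omega> x) \<le> \<bar>v' y\<bar> * \<bar>\<theta>' \<omega> x\<bar>"
        using abs_ge_self[of "t * (v' y * \<theta>' \<omega> x)"] assms(2) by (simp add: abs_mult)
      ultimately show ?thesis by (simp add: mult_ac)
    qed
    ultimately have "t * (s * (g' \<omega> x / g_word g \<theta> \<omega> x) * v y + v' y * \<theta>' \<omega> x)
        \<le> (s * c + K * M) * v y"
      by (simp add: algebra_simps)
    then have "g_word g \<theta> \<omega> x powr s *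
        (t * (s * (g' \<omega> x / g_word g \<theta> \<omega> x) * v y + v' y * \<theta>' \<omega> x))
        \<le> g_word g \<theta> \<omega> x powr s * ((s * c + K * M) * v y)"
      by (rule mult_left_mono) simp
    then show ?thesis unfolding y_def[symmetric] by (simp only: mult_ac)
  qed
  have "ev ^ n * (t * v' x) = t * (ev ^ n * v' x)" by simp
  also have "\<dots> \<le> (s * c + K * M) * (ev ^ n * v x)"
    unfolding eigen_iterate_deriv[OF x] eigen_iterate[OF x'] sum_distrib_left
    by (rule sum_mono) (use summand in \<open>simp only: sum_distrib_left\<close>)
  finally have "ev ^ n * (t * v' x) \<le> ev ^ n * ((s * c + K * M) * v x)"
    by (simp only: mult_ac)
  then show "t * v' x \<le> (s * c + K * M) * v x"
    using ev_pos by (simp add: mult_le_cancel_left_pos)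
qed

lemma abs_log_deriv_le:
  assumes "s \<ge> 0" "0 \<le> \<kappa>" "\<kappa> < 1"
    and "\<And>\<omega> x y. \<omega> \<in> words B n \<Longrightarrow> x \<in> {a..b} \<Longrightarrow> y \<in> {a..b} \<Longrightarrow>
           \<bar>theta_word \<theta> \<omega> x - theta_word \<theta> \<omega> y\<bar> \<le> \<kappa> * \<bar>x - y\<bar>"
    and c: "\<And>\<omega> x. \<omega> \<in> words B n \<Longrightarrow> x \<in> {a..b} \<Longrightarrow> \<bar>g' \<omega> x\<bar> / g_word g \<theta> \<omega> x \<le> c"
  shows "M \<le> c * s / (1 - \<kappa>)"
proof -
  have "\<bar>v' x\<bar> / v x \<le> s * c + \<kappa> * M" if x: "x \<in> {a..b}" for x
  proof -
    have "t * v' x \<le> (s * c + \<kappa> * M) * v x" if "\<bar>t\<bar> = 1" for t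
    proof (rule deriv_le[OF assms(1) that assms(2) assms(4) _ x])
      fix \<omega> x assume \<omega>: "\<omega> \<in> words B n" and x: "x \<in> {a..b}"
      have "t * (g' \<omega> x / g_word g \<theta> \<omega> x) \<le> \<bar>g' \<omega> x\<bar> / g_word g \<theta> \<omega> x"
        using abs_ge_self[of "t * (g' \<omega> x / g_word g \<theta> \<omega> x)"] that g_word_pos[OF \<omega> x]
        by (simp add: abs_mult)
      then show "t * (g' \<omega> x / g_word g \<theta> \<omega> x) \<le> c" using c[OF \<omega> x] by linarith
    qed
    from this[of 1] this[of "-1"] have "\<bar>v' x\<bar> \<le> (s * c + \<kappa> * M) * v x" by simp
    then show ?thesis using v_pos[OF x] by (simp add: pos_divide_le_eq)
  qed
  \<comment> \<open>The pointwise bound already contains \<open>M\<close>; passing to the supremum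
    puts \<open>M\<close> on both sides, and \<open>\<kappa> < 1\<close> allows solving for
    it.\<close>
  then have "M \<le> s * c + \<kappa> * M"
    unfolding M_def using ab by (intro cSUP_least) auto
  then show ?thesis using assms(3) by (simp add: pos_le_divide_eq algebra_simps)
qed

text \<open>Over words of length \<open>n * \<mu>\<close> the weights contribute nothing positive,
  and the maps at most \<open>\<kappa> ^ n * M * v x\<close>, which tends to 0.\<close>

lemma deriv_sign:
  assumes "s \<ge> 0" "0 \<le> \<kappa>" "\<kappa> < 1" "\<mu> \<ge> 1" "\<bar>t\<bar> = 1"
    and K: "\<And>\<omega> x y. \<omega> \<in> words B \<mu> \<Longrightarrow> x \<in> {a..b} \<Longrightarrow> y \<in> {a..b} \<Longrightarrow>
           \<bar>theta_word \<theta> \<omega> x - theta_word \<theta> \<omega> y\<bar> \<le> \<kappa> * \<bar>x - y\<bar>"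
    and c: "\<And>\<nu> \<omega> x. \<nu> \<ge> 1 \<Longrightarrow> \<omega> \<in> words B \<nu> \<Longrightarrow> x \<in> {a..b} \<Longrightarrow>
           t * g' \<omega> x / g_word g \<theta> \<omega> x \<le> 0"
    and x: "x \<in> {a..b}"
  shows "t * v' x \<le> 0"
proof (rule LIMSEQ_le_const)
  have "(\<lambda>n. \<kappa> ^ n * M * v x) \<longlonglongrightarrow> 0 * M * v x"
    using assms(2,3) by (intro tendsto_intros LIMSEQ_realpow_zero)
  then show "(\<lambda>n. \<kappa> ^ n * M * v x) \<longlonglongrightarrow> 0" by simp
  have "t * v' x \<le> \<kappa> ^ n * M * v x" if "n \<ge> 1" for n
  proof -
    \<comment> \<open>The sign hypothesis speaks of nonempty words, hence the restriction to
      \<open>n \<ge> 1\<close>.\<close>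
    have "1 \<le> n * \<mu>" using mult_le_mono[OF that assms(4)] by simp
    then have "t * (g' \<omega> x / g_word g \<theta> \<omega> x) \<le> 0" if "\<omega> \<in> words B (n * \<mu>)" "x \<in> {a..b}" for \<omega> x
      using c[OF \<open>1 \<le> n * \<mu>\<close> that] by simp
    then have "t * v' x \<le> (s * 0 + \<kappa> ^ n * M) * v x"
      using assms(2) by (intro deriv_le[OF assms(1,5) _ _ _ x]
        Lipschitz_theta_word_iterate[OF assms(2) K]) auto
    then show ?thesis by simp
  qed
  then show "\<exists>N. \<forall>n\<ge>N. t * v' x \<le> \<kappa> ^ n * M * v x" by blast
qed

end

section \<open>Application to the given system and its spectral radius\<close>

theorem theorem5p1:
  fixes a1 a2 :: real and B :: "'i set" and m \<mu> :: nat and \<kappa> C1 :: real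
    and g \<theta> :: "'i \<Rightarrow> real \<Rightarrow> real"
  assumes "a1 < a2" and "finite B" and "B \<noteq> {}" and "m \<ge> 1"
    and "\<And>i. i \<in> B \<Longrightarrow> g i \<in> Cm_space a1 a2 m"
    and "\<And>i. i \<in> B \<Longrightarrow> \<theta> i \<in> Cm_space a1 a2 m"
    and "\<And>i x. i \<in> B \<Longrightarrow> x \<in> {a1..a2} \<Longrightarrow> g i x > 0"
    and "\<And>i. i \<in> B \<Longrightarrow> \<theta> i ` {a1<..<a2} \<subseteq> {a1<..<a2}"
    and "\<mu> \<ge> 1" and "\<kappa> < 1"
    and "\<And>\<omega> x y. \<omega> \<in> words B \<mu> \<Longrightarrow> x \<in> {a1..a2} \<Longrightarrow> y \<in> {a1..a2} \<Longrightarrow>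
           \<bar>theta_word \<theta> \<omega> x - theta_word \<theta> \<omega> y\<bar> \<le> \<kappa> * \<bar>x - y\<bar>"
    and "C1 = Sup {\<bar>ext_deriv a1 a2 1 (g_word g \<theta> \<omega>) x\<bar> / g_word g \<theta> \<omega> x | \<omega> x.
                     \<omega> \<in> words B \<mu> \<and> x \<in> {a1..a2}}"
  shows "(\<forall>s>0. \<forall>v. positive_eigenfunction a1 a2 m B g \<theta> s v \<longrightarrow>
            Sup {\<bar>ext_deriv a1 a2 1 v x\<bar> / v x | x. x \<in> {a1..a2}} \<le> C1 * s / (1 - \<kappa>)) \<and>
         (\<forall>\<delta>\<in>{0, 1::nat}.
            (\<forall>\<nu>\<ge>1. \<forall>\<omega>\<in>words B \<nu>. \<forall>x\<in>{a1..a2}.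
               (- 1) ^ \<delta> * ext_deriv a1 a2 1 (g_word g \<theta> \<omega>) x / g_word g \<theta> \<omega> x \<le> 0) \<longrightarrow>
            (\<forall>s>0. \<forall>v. positive_eigenfunction a1 a2 m B g \<theta> s v \<longrightarrow>
               (\<forall>x\<in>{a1..a2}. (- 1) ^ \<delta> * ext_deriv a1 a2 1 v x \<le> 0)))"
proof -
  note Lip = assms(11) and C1 = assms(12)
  have "Cm_space a1 a2 m \<subseteq> Cm_space a1 a2 1"
    using \<open>m \<ge> 1\<close> by (rule Cm_space_antimono)
  then interpret C1_system a1 a2 B g \<theta>
    using assms(1-8) by unfold_locales auto
  \<comment> \<open>Nonnegativity follows from the contraction inequality for any one word at the
    two distinct endpoints.\<close>
  have \<kappa>: "0 \<le> \<kappa>"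
  proof -
    obtain \<omega> where "\<omega> \<in> words B \<mu>" using words_nonempty[OF nonempty] by blast
    from Lip[OF this, of a1 a2] have "0 \<le> \<kappa> * \<bar>a1 - a2\<bar>" using ab by auto
    then show ?thesis using ab by (simp add: zero_le_mult_iff)
  qed
  have C1_upper: "\<bar>ext_deriv a1 a2 1 (g_word g \<theta> \<omega>) x\<bar> / g_word g \<theta> \<omega> x \<le> C1"
    if "\<omega> \<in> words B \<mu>" "x \<in> {a1..a2}" for \<omega> x
    unfolding C1
  proof (rule cSup_upper)
    let ?q = "\<lambda>\<omega> x. \<bar>ext_deriv a1 a2 1 (g_word g \<theta> \<omega>) x\<bar> / g_word g \<theta> \<omega> x"
    \<comment> \<open>There are finitely many words of length \<open>\<mu>\<close>, and for each the
      quotient is bounded by compactness; hence \<open>C1\<close> is a true upper bound.\<close>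
    have "bdd_above (\<Union>\<omega>\<in>words B \<mu>. ?q \<omega> ` {a1..a2})"
      unfolding bdd_above_UN[OF finite_words[OF fin]]
      by (intro ballI bdd_above_abs_ratio g_word_pos ext_deriv_1_continuous[OF ab] g_word_C1
        Cm_space_continuous[OF g_word_C1])
    also have "(\<Union>\<omega>\<in>words B \<mu>. ?q \<omega> ` {a1..a2})
        = {?q \<omega> x | \<omega> x. \<omega> \<in> words B \<mu> \<and> x \<in> {a1..a2}}"
      by blast
    finally show "bdd_above {?q \<omega> x | \<omega> x. \<omega> \<in> words B \<mu> \<and> x \<in> {a1..a2}}" .
  qed (use that in blast)
  \<comment> \<open>The eigenvalue \<open>ev\<close> of the locale becomes the spectral radius on
    the C^m space, while the eigenfunction is regarded as a C^1 function.\<close>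
  have vec: "positive_eigenvector a1 a2 B g \<theta> s
      (Cm_spectral_radius a1 a2 m (transfer_op B g \<theta> s)) v"
    if "positive_eigenfunction a1 a2 m B g \<theta> s v" for s v
    using that \<open>Cm_space a1 a2 m \<subseteq> Cm_space a1 a2 1\<close>
    unfolding positive_eigenfunction_def by unfold_locales auto
  show ?thesis
  proof (intro conjI ballI allI impI)
    fix s :: real and v
    assume "s > 0" and v: "positive_eigenfunction a1 a2 m B g \<theta> s v"
    interpret positive_eigenvector a1 a2 B g \<theta> s
      "Cm_spectral_radius a1 a2 m (transfer_op B g \<theta> s)" v
      using v by (rule vec)
    have "M \<le> C1 * s / (1 - \<kappa>)"
      using \<open>s > 0\<close> \<kappa> \<open>\<kappa> < 1\<close> Lip C1_upper by (intro abs_log_deriv_le[of \<kappa> \<mu>]) auto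
    moreover have "{\<bar>ext_deriv a1 a2 1 v x\<bar> / v x | x. x \<in> {a1..a2}}
        = (\<lambda>x. \<bar>ext_deriv a1 a2 1 v x\<bar> / v x) ` {a1..a2}"
      by blast
    ultimately show "Sup {\<bar>ext_deriv a1 a2 1 v x\<bar> / v x | x. x \<in> {a1..a2}} \<le> C1 * s / (1 - \<kappa>)"
      by (simp add: M_def)
  next
    fix \<delta> :: nat and s x :: real and v
    assume sign: "\<forall>\<nu>\<ge>1. \<forall>\<omega>\<in>words B \<nu>. \<forall>x\<in>{a1..a2}.
        (- 1) ^ \<delta> * ext_deriv a1 a2 1 (g_word g \<theta> \<omega>) x / g_word g \<theta> \<omega> x \<le> 0"
      and "s > 0" and v: "positive_eigenfunction a1 a2 m B g \<theta> s v" and x: "x \<in> {a1..a2}"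
    interpret positive_eigenvector a1 a2 B g \<theta> s
      "Cm_spectral_radius a1 a2 m (transfer_op B g \<theta> s)" v
      using v by (rule vec)
    show "(- 1) ^ \<delta> * ext_deriv a1 a2 1 v x \<le> 0"
      using \<open>s > 0\<close> sign by (intro deriv_sign[OF _ \<kappa> \<open>\<kappa> < 1\<close> \<open>\<mu> \<ge> 1\<close> _ Lip _ x]) auto
  qed
qed

end
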